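(* Let $\delta>0$. For each $n$, let $C_n=[-1/2,1/2]^n$, let $\mathbb{T}=\mathbb{T}_n$ be a packing torus of $C_n-C_n=2C_n$, and let $\mathbf{X}\subseteq\mathbb{T}$ be sampled from the Poisson point process on $\mathbb{T}$ with intensity \[ \rho=n\ln n-(1+\delta)\,n\ln\ln n. \] Then $\mathbb{P}[\mathbb{T}\subseteq\mathbf{X}+C_n]\to0$ as $n\to\infty$.
   Context: A lattice $\Lambda\subseteq\mathbb{R}^n$ is the set of integer combinations of $n$ linearly independent vectors; it is a packing lattice of a convex body $L$ if the translates $L+\mathbf{p}$, $\mathbf{p}\in\Lambda$, are pairwise disjoint, and then $\mathbb{T}=\mathbb{R}^n/\Lambda$ is a packing torus of $L$. Volume on $\mathbb{T}$ is Lebesgue measure transferred from a fundamental domain of $\Lambda$. $\mathbf{X}+C_n$ denotes the image in $\mathbb{T}$ of $\{\mathbf{x}+\mathbf{c}:\mathbf{x}\in\mathbf{X},\mathbf{c}\in C_n\}$. A random set $\mathbf{X}\subseteq\mathbb{T}$ is sampled from the Poisson point process with intensity $\rho$ if for each measurable $S\subseteq\mathbb{T}$, $|\mathbf{X}\cap S|$ is Poisson with mean $\rho\operatorname{vol}(S)$, with counts in disjoint sets independent. *)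

theory Defs
  imports "HOL-Probability.Probability"
begin

text \<open>
  The dimension varies inside the statement, so \<open>\<real>\<^sup>n\<close> is the set of extensional functions on
  \<open>{..<n}\<close>, i.e. the underlying space of the product measure \<open>lebesgue_measure n\<close> below.
  Vector operations are restricted to \<open>{..<n}\<close> in order to stay in this set.
\<close>

definition rvec :: "nat \<Rightarrow> (nat \<Rightarrow> real) set" where
  "rvec n = {..<n} \<rightarrow>\<^sub>E UNIV"

definition lebesgue_measure :: "nat \<Rightarrow> (nat \<Rightarrow> real) measure" where
  "lebesgue_measure n = Pi\<^sub>M {..<n} (\<lambda>_. lborel)"

definition vadd :: "nat \<Rightarrow> (nat \<Rightarrow> real) \<Rightarrow> (nat \<Rightarrow> real) \<Rightarrow> (nat \<Rightarrow> real)" where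
  "vadd n x y = (\<lambda>i\<in>{..<n}. x i + y i)"

definition vdiff :: "nat \<Rightarrow> (nat \<Rightarrow> real) \<Rightarrow> (nat \<Rightarrow> real) \<Rightarrow> (nat \<Rightarrow> real)" where
  "vdiff n x y = (\<lambda>i\<in>{..<n}. x i - y i)"

definition lincomb :: "nat \<Rightarrow> (nat \<Rightarrow> nat \<Rightarrow> real) \<Rightarrow> (nat \<Rightarrow> real) \<Rightarrow> (nat \<Rightarrow> real)" where
  "lincomb n b c = (\<lambda>i\<in>{..<n}. \<Sum>j<n. c j * b j i)"

definition minkowski_diff ::
  "nat \<Rightarrow> (nat \<Rightarrow> real) set \<Rightarrow> (nat \<Rightarrow> real) set \<Rightarrow> (nat \<Rightarrow> real) set" where
  "minkowski_diff n A B = {vdiff n x y | x y. x \<in> A \<and> y \<in> B}"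

definition cube :: "nat \<Rightarrow> (nat \<Rightarrow> real) set" where
  "cube n = {..<n} \<rightarrow>\<^sub>E {-1/2..1/2}"

definition lin_indep_family :: "nat \<Rightarrow> (nat \<Rightarrow> nat \<Rightarrow> real) \<Rightarrow> bool" where
  "lin_indep_family n b \<longleftrightarrow>
     (\<forall>c. lincomb n b c = (\<lambda>i\<in>{..<n}. 0) \<longrightarrow> (\<forall>j<n. c j = 0))"

definition is_lattice :: "nat \<Rightarrow> (nat \<Rightarrow> real) set \<Rightarrow> bool" where
  "is_lattice n \<Lambda> \<longleftrightarrow>
     (\<exists>b. (\<forall>j<n. b j \<in> rvec n) \<and> lin_indep_family n b \<and>
          \<Lambda> = {lincomb n b (\<lambda>j. real_of_int (k j)) | k. True})"

definition packing_lattice :: "nat \<Rightarrow> (nat \<Rightarrow> real) set \<Rightarrow> (nat \<Rightarrow> real) set \<Rightarrow> bool" where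
  "packing_lattice n \<Lambda> L \<longleftrightarrow>
     is_lattice n \<Lambda> \<and> disjoint_family_on (\<lambda>p. (\<lambda>x. vadd n x p) ` L) \<Lambda>"

definition cong_rel :: "nat \<Rightarrow> (nat \<Rightarrow> real) set \<Rightarrow> ((nat \<Rightarrow> real) \<times> (nat \<Rightarrow> real)) set" where
  "cong_rel n \<Lambda> = {(x, y). x \<in> rvec n \<and> y \<in> rvec n \<and> vdiff n x y \<in> \<Lambda>}"

definition torus :: "nat \<Rightarrow> (nat \<Rightarrow> real) set \<Rightarrow> (nat \<Rightarrow> real) set set" where
  "torus n \<Lambda> = rvec n // cong_rel n \<Lambda>"

definition torus_proj :: "nat \<Rightarrow> (nat \<Rightarrow> real) set \<Rightarrow> (nat \<Rightarrow> real) \<Rightarrow> (nat \<Rightarrow> real) set" where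
  "torus_proj n \<Lambda> x = cong_rel n \<Lambda> `` {x}"

definition fundamental_domain :: "nat \<Rightarrow> (nat \<Rightarrow> real) set \<Rightarrow> (nat \<Rightarrow> real) set \<Rightarrow> bool" where
  "fundamental_domain n \<Lambda> F \<longleftrightarrow>
     F \<in> sets (lebesgue_measure n) \<and> (\<forall>t\<in>torus n \<Lambda>. \<exists>!x. x \<in> t \<inter> F)"

text \<open>
  Volume on the torus: the push-forward of Lebesgue measure on a fundamental domain, on the
  quotient \<open>\<sigma>\<close>-algebra. Fundamental domains exist (\<open>fundamental_domain_exists\<close>), and by translation
  invariance of Lebesgue measure the choice among them does not affect the result.
\<close>

definition torus_measure :: "nat \<Rightarrow> (nat \<Rightarrow> real) set \<Rightarrow> (nat \<Rightarrow> real) set measure" where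
  "torus_measure n \<Lambda> =
     distr (restrict_space (lebesgue_measure n) (SOME F. fundamental_domain n \<Lambda> F))
       (sigma (torus n \<Lambda>)
          {S \<in> Pow (torus n \<Lambda>). torus_proj n \<Lambda> -` S \<inter> rvec n \<in> sets (lebesgue_measure n)})
       (torus_proj n \<Lambda>)"

text \<open>
  The set \<open>\<Union>A\<close> consists of all representatives in \<open>\<real>\<^sup>n\<close> of the points of \<open>A\<close>.
\<close>

definition torus_plus ::
  "nat \<Rightarrow> (nat \<Rightarrow> real) set \<Rightarrow> (nat \<Rightarrow> real) set set \<Rightarrow> (nat \<Rightarrow> real) set \<Rightarrow> (nat \<Rightarrow> real) set set"
where
  "torus_plus n \<Lambda> A C = {torus_proj n \<Lambda> (vadd n x c) | x c. x \<in> \<Union>A \<and> c \<in> C}"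

text \<open>
  Poisson point process on a space \<open>N\<close> of finite volume. The formula for the point probabilities
  includes mean 0 (the count is almost surely 0, as \<open>0 ^ 0 = 1\<close>). The count of the
  whole space is a Poisson variable, so samples are finite; this is demanded surely rather than
  almost surely because \<open>card\<close> is 0 on infinite sets.
\<close>

definition poisson_process ::
  "'w measure \<Rightarrow> ('w \<Rightarrow> 't set) \<Rightarrow> 't measure \<Rightarrow> real \<Rightarrow> bool" where
  "poisson_process M X N \<rho> \<longleftrightarrow>
     prob_space M \<and>
     (\<forall>\<omega>\<in>space M. finite (X \<omega>) \<and> X \<omega> \<subseteq> space N) \<and>
     (\<forall>S\<in>sets N. (\<lambda>\<omega>. card (X \<omega> \<inter> S)) \<in> M \<rightarrow>\<^sub>M count_space UNIV \<and>
        (\<forall>k. measure M {\<omega> \<in> space M. card (X \<omega> \<inter> S) = k} =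
               exp (- (\<rho> * measure N S)) * (\<rho> * measure N S) ^ k / fact k)) \<and>
     (\<forall>(I :: nat set) A. finite I \<and> A ` I \<subseteq> sets N \<and> disjoint_family_on A I \<longrightarrow>
        prob_space.indep_vars M (\<lambda>_. count_space UNIV) (\<lambda>i \<omega>. card (X \<omega> \<inter> A i)) I)"

definition intensity :: "real \<Rightarrow> nat \<Rightarrow> real" where
  "intensity \<delta> n = real n * ln (real n) - (1 + \<delta>) * real n * ln (ln (real n))"

lemma minkowski_diff_cube: "minkowski_diff n (cube n) (cube n) = {..<n} \<rightarrow>\<^sub>E {-1..1}"
proof (intro equalityI subsetI)
  fix z assume "z \<in> minkowski_diff n (cube n) (cube n)"
  then obtain x y where z: "z = vdiff n x y" and x: "x \<in> cube n" and y: "y \<in> cube n"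
    by (auto simp: minkowski_diff_def)
  have "x i - y i \<in> {-1..1}" if "i < n" for i
  proof -
    have "x i \<in> {-1/2..1/2}" "y i \<in> {-1/2..1/2}"
      using x y that by (auto simp: cube_def PiE_iff)
    then show ?thesis by simp
  qed
  then show "z \<in> {..<n} \<rightarrow>\<^sub>E {-1..1}"
    by (auto simp: z vdiff_def PiE_iff)
next
  fix z :: "nat \<Rightarrow> real" assume z: "z \<in> {..<n} \<rightarrow>\<^sub>E {-1..1}"
  have "z = vdiff n (\<lambda>i\<in>{..<n}. z i / 2) (\<lambda>i\<in>{..<n}. - z i / 2)"
    using z by (auto simp: vdiff_def PiE_iff fun_eq_iff extensional_def)
  moreover have "(\<lambda>i\<in>{..<n}. z i / 2) \<in> cube n" "(\<lambda>i\<in>{..<n}. - z i / 2) \<in> cube n"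
    using z by (auto simp: cube_def PiE_iff)
  ultimately show "z \<in> minkowski_diff n (cube n) (cube n)"
    unfolding minkowski_diff_def by blast
qed

lemma nontrivial_relation:
  fixes a :: "nat \<Rightarrow> nat \<Rightarrow> real"
  assumes "finite J" "n < card J"
  shows "\<exists>c. (\<exists>j\<in>J. c j \<noteq> 0) \<and> (\<forall>i<n. (\<Sum>j\<in>J. c j * a j i) = 0)"
  using assms
proof (induction n arbitrary: J a)
  case 0
  then have "J \<noteq> {}" by auto
  then show ?case by (intro exI[of _ "\<lambda>_. 1"]) auto
next
  case (Suc n)
  show ?case
  proof (cases "\<forall>j\<in>J. a j n = 0")
    case True
    obtain c where "\<exists>j\<in>J. c j \<noteq> 0" "\<forall>i<n. (\<Sum>j\<in>J. c j * a j i) = 0"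
      using Suc.IH[of J a] Suc.prems by auto
    then show ?thesis using True by (intro exI[of _ c]) (auto simp: less_Suc_eq)
  next
    case False
    then obtain k where k: "k \<in> J" "a k n \<noteq> 0" by blast
    define a' where "a' = (\<lambda>j i. a j i - a j n / a k n * a k i)"
    have "finite (J - {k})" "n < card (J - {k})"
      using Suc.prems k by auto
    from Suc.IH[OF this, of a'] obtain c where
      c: "\<exists>j\<in>J - {k}. c j \<noteq> 0" "\<forall>i<n. (\<Sum>j\<in>J - {k}. c j * a' j i) = 0" by auto
    define s where "s = (\<Sum>j\<in>J - {k}. c j * a j n) / a k n"
    define d where "d = c(k := - s)"
    have sum_d: "(\<Sum>j\<in>J. d j * a j i) = (\<Sum>j\<in>J - {k}. c j * a' j i)" for i
    proof -
      have "(\<Sum>j\<in>J. d j * a j i) = - s * a k i + (\<Sum>j\<in>J - {k}. c j * a j i)"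
        using Suc.prems k by (subst sum.remove[of J k]) (auto simp: d_def intro!: sum.cong)
      also have "s * a k i = (\<Sum>j\<in>J - {k}. c j * (a j n / a k n * a k i))"
        by (simp add: s_def sum_divide_distrib sum_distrib_right mult.assoc)
      then have "- s * a k i + (\<Sum>j\<in>J - {k}. c j * a j i) = (\<Sum>j\<in>J - {k}. c j * a' j i)"
        by (simp add: a'_def right_diff_distrib sum_subtractf)
      finally show ?thesis .
    qed
    have "a' j n = 0" for j using k by (simp add: a'_def)
    then have "\<forall>i<Suc n. (\<Sum>j\<in>J. d j * a j i) = 0"
      using c by (auto simp: sum_d less_Suc_eq)
    moreover have "\<exists>j\<in>J. d j \<noteq> 0" using c by (auto simp: d_def)
    ultimately show ?thesis by blast
  qed
qed

lemma lin_indep_family_spans: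
  assumes "lin_indep_family n b"
  shows "\<exists>c. \<forall>i<n. (\<Sum>j<n. c j * b j i) = x i"
proof -
  obtain c where c: "\<exists>j\<in>{..n}. c j \<noteq> 0"
    "\<forall>i<n. (\<Sum>j\<in>{..n}. c j * (b(n := x)) j i) = 0"
    using nontrivial_relation[of "{..n}" n "b(n := x)"] by auto
  have eq: "(\<Sum>j<n. c j * b j i) + c n * x i = 0" if "i < n" for i
  proof -
    have "(\<Sum>j\<in>{..n}. c j * (b(n := x)) j i) = (\<Sum>j<n. c j * b j i) + c n * x i"
      by (simp add: lessThan_Suc_atMost[symmetric])
    then show ?thesis using c that by simp
  qed
  have "c n \<noteq> 0"
  proof
    assume 0: "c n = 0"
    then have "lincomb n b c = (\<lambda>i\<in>{..<n}. 0)"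
      using eq by (auto simp: lincomb_def fun_eq_iff)
    then have "\<forall>j<n. c j = 0" using assms by (auto simp: lin_indep_family_def)
    then show False using c 0 by (metis atMost_iff nat_less_le)
  qed
  then have "(\<Sum>j<n. (- c j / c n) * b j i) = x i" if "i < n" for i
  proof -
    have "(\<Sum>j<n. (- c j / c n) * b j i) = - (\<Sum>j<n. c j * b j i) / c n"
      by (simp add: sum_divide_distrib sum_negf)
    also have "\<dots> = x i" using eq[OF that] \<open>c n \<noteq> 0\<close> by (simp add: field_simps)
    finally show ?thesis .
  qed
  then show ?thesis by (intro exI[of _ "\<lambda>j. - c j / c n"] allI impI)
qed

lemma fundamental_domain_exists:
  assumes "is_lattice n \<Lambda>"
  shows "\<exists>F. fundamental_domain n \<Lambda> F"
proof -
  obtain b where ind: "lin_indep_family n b"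
    and \<Lambda>: "\<Lambda> = {lincomb n b (\<lambda>j. real_of_int (k j)) | k. True}"
    using assms by (auto simp: is_lattice_def)
  obtain d where d: "\<And>l i. i < n \<Longrightarrow> (\<Sum>j<n. d l j * b j i) = (if i = l then 1 else 0)"
    using lin_indep_family_spans[OF ind, of "\<lambda>i. if i = l then 1 else 0" for l] by metis
  define t where "t = (\<lambda>x j. \<Sum>l<n. x l * d l j)"
  have expand: "(\<Sum>j<n. t x j * b j i) = x i" if "i < n" for x i
  proof -
    have "(\<Sum>j<n. t x j * b j i) = (\<Sum>j<n. \<Sum>l<n. x l * (d l j * b j i))"
      by (simp add: t_def sum_distrib_right mult.assoc)
    also have "\<dots> = (\<Sum>l<n. x l * (\<Sum>j<n. d l j * b j i))"
      by (subst sum.swap) (simp add: sum_distrib_left)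
    also have "\<dots> = (\<Sum>l<n. if l = i then x l else 0)"
      using d[OF that] by (intro sum.cong) auto
    also have "\<dots> = x i" using that by simp
    finally show ?thesis .
  qed
  have unique: "c j = t x j"
    if "\<And>i. i < n \<Longrightarrow> (\<Sum>j<n. c j * b j i) = x i" "j < n" for c x j
  proof -
    have "lincomb n b (\<lambda>j. c j - t x j) = (\<lambda>i\<in>{..<n}. 0)"
      using that(1) expand
      by (auto simp: lincomb_def fun_eq_iff left_diff_distrib sum_subtractf)
    then have "c j - t x j = 0"
      using ind \<open>j < n\<close> unfolding lin_indep_family_def by blast
    then show ?thesis by simp
  qed
  have lattice_coord: "vdiff n x y \<in> \<Lambda> \<longleftrightarrow> (\<forall>j<n. t x j - t y j \<in> \<int>)" for x y
  proof
    assume "vdiff n x y \<in> \<Lambda>"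
    then obtain k where k: "vdiff n x y = lincomb n b (\<lambda>j. real_of_int (k j))"
      by (auto simp: \<Lambda>)
    have eq: "(\<Sum>j<n. (real_of_int (k j) + t y j) * b j i) = x i" if "i < n" for i
      using fun_cong[OF k, of i] expand[OF that, of y] that
      by (simp add: vdiff_def lincomb_def distrib_right sum.distrib)
    have "t x j - t y j = real_of_int (k j)" if "j < n" for j
      using unique[OF eq that] by simp
    then show "\<forall>j<n. t x j - t y j \<in> \<int>" by simp
  next
    assume *: "\<forall>j<n. t x j - t y j \<in> \<int>"
    have "vdiff n x y = lincomb n b (\<lambda>j. real_of_int \<lfloor>t x j - t y j\<rfloor>)"
    proof
      fix i
      show "vdiff n x y i = lincomb n b (\<lambda>j. real_of_int \<lfloor>t x j - t y j\<rfloor>) i"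
      proof (cases "i < n")
        case True
        have "(\<Sum>j<n. real_of_int \<lfloor>t x j - t y j\<rfloor> * b j i) = (\<Sum>j<n. (t x j - t y j) * b j i)"
          using * by (intro sum.cong) auto
        then show ?thesis using True expand
          by (simp add: vdiff_def lincomb_def left_diff_distrib sum_subtractf)
      qed (simp add: vdiff_def lincomb_def)
    qed
    then show "vdiff n x y \<in> \<Lambda>" by (auto simp: \<Lambda>)
  qed
  define F where "F = {x \<in> space (lebesgue_measure n). \<forall>j\<in>{..<n}. 0 \<le> t x j \<and> t x j < 1}"
  have space_eq: "space (lebesgue_measure n) = rvec n"
    by (simp add: lebesgue_measure_def rvec_def space_PiM)
  have "F \<in> sets (lebesgue_measure n)"
    unfolding F_def t_def lebesgue_measure_def by measurable
  moreover have "\<exists>!y. y \<in> T \<inter> F" if T: "T \<in> torus n \<Lambda>" for T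
  proof -
    obtain x where x: "x \<in> rvec n" and Tx: "T = cong_rel n \<Lambda> `` {x}"
      using T by (auto simp: torus_def quotient_def)
    define y where "y = lincomb n b (\<lambda>j. frac (t x j))"
    have yt: "t y j = frac (t x j)" if "j < n" for j
      using unique[of "\<lambda>j. frac (t x j)" y j] that by (auto simp: y_def lincomb_def)
    have "y \<in> rvec n" by (auto simp: y_def lincomb_def rvec_def)
    moreover have "vdiff n x y \<in> \<Lambda>"
      by (auto simp: lattice_coord yt frac_def)
    ultimately have "y \<in> T \<inter> F"
      using x by (auto simp: Tx cong_rel_def F_def space_eq yt frac_lt_1)
    moreover have "z = y" if z: "z \<in> T \<inter> F" for z
    proof
      fix i
      have zr: "z \<in> rvec n" and zd: "\<forall>j<n. t x j - t z j \<in> \<int>"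
        and z01: "\<forall>j<n. 0 \<le> t z j \<and> t z j < 1"
        using z by (auto simp: Tx cong_rel_def F_def lattice_coord)
      have "t z j = t y j" if "j < n" for j
        using zd z01 that frac_unique_iff[of "t x j" "t z j"] by (simp add: yt)
      then have "(\<Sum>j<n. t z j * b j i) = (\<Sum>j<n. t y j * b j i)" by simp
      then show "z i = y i"
        using expand[of i z] expand[of i y] zr \<open>y \<in> rvec n\<close>
        by (cases "i < n") (auto simp: rvec_def PiE_iff extensional_def)
    qed
    ultimately show ?thesis by blast
  qed
  ultimately have "fundamental_domain n \<Lambda> F"
    unfolding fundamental_domain_def by (intro conjI ballI)
  then show ?thesis by (rule exI)
qed

end

theory Submission
  imports Defs "HOL-Real_Asymp.Real_Asymp"
begin

text \<open>
  The proof is a second moment argument over finitely many test points. Take the \<open>n\<^sup>n\<close> grid points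
  of spacing \<open>1/n\<close> in \<open>C\<^sub>n\<close>. Their translates of \<open>C\<^sub>n\<close> lie in \<open>2C\<^sub>n\<close>, which embeds into the torus
  preserving volume. So each test point is uncovered with probability \<open>exp (- \<rho>)\<close>, and two test points
  \<open>x, y\<close> are both uncovered with probability \<open>exp (- 2\<rho> + \<rho> \<Prod>\<^sub>i (1 - \<bar>x\<^sub>i - y\<^sub>i\<bar>))\<close>, and by Chebyshev's inequality
  the torus is covered with probability at most the average of \<open>exp (\<rho> \<Prod>\<^sub>i (1 - \<bar>x\<^sub>i - y\<^sub>i\<bar>))\<close> minus 1.
  Expanding the exponential, the average factorizes over the coordinates and gives
  \<open>\<Sum>\<^sub>k\<^sub>\<ge>\<^sub>1 \<rho>\<^sup>k / k! D\<^sub>k\<^sup>n\<close> with \<open>D\<^sub>k \<le> 1/n + 2/(k+2)\<close>. The terms with \<open>k \<le> n / ln n\<close> are exponentially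
  small; for the others \<open>D\<^sub>k \<le> 3 ln n / n\<close>, so they contribute at most
  \<open>exp \<rho> (3 ln n / n)\<^sup>n = 3\<^sup>n (ln n) powr (- \<delta> n)\<close>.
\<close>

subsection \<open>The torus\<close>

lemma space_lebesgue_measure: "space (lebesgue_measure n) = rvec n"
  by (simp add: lebesgue_measure_def rvec_def space_PiM)

lemma vadd_in_rvec [simp]: "vadd n x y \<in> rvec n"
  and vdiff_in_rvec [simp]: "vdiff n x y \<in> rvec n"
  by (auto simp: vadd_def vdiff_def rvec_def)

lemma rvec_eqI:
  assumes "x \<in> rvec n" "y \<in> rvec n" "\<And>i. i < n \<Longrightarrow> x i = y i"
  shows "x = y"
  using assms by (auto simp: rvec_def intro: PiE_ext)

lemma vdiff_vadd_cancel: "x \<in> rvec n \<Longrightarrow> vdiff n (vadd n x p) p = x"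
  by (rule rvec_eqI[OF vdiff_in_rvec]) (auto simp: vdiff_def vadd_def rvec_def)

lemma vdiff_vdiff_cancel: "x \<in> rvec n \<Longrightarrow> vdiff n z (vdiff n z x) = x"
  by (rule rvec_eqI[OF vdiff_in_rvec]) (auto simp: vdiff_def rvec_def)

lemma vadd_vdiff_right: "z \<in> rvec n \<Longrightarrow> vadd n x (vdiff n z x) = z"
  by (rule rvec_eqI[OF vadd_in_rvec]) (auto simp: vdiff_def vadd_def)

lemma vdiff_vadd_left: "p \<in> rvec n \<Longrightarrow> vdiff n (vadd n x p) x = p"
  by (rule rvec_eqI[OF vdiff_in_rvec]) (auto simp: vdiff_def vadd_def)

text \<open>These are the subgroup laws of a lattice, phrased through \<open>vdiff\<close> so that
  they give at once that \<open>cong_rel\<close> is an equivalence. Countability later makes unions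
  over \<open>\<Lambda>\<close> measurable.\<close>

lemma
  assumes "is_lattice n \<Lambda>"
  shows lattice_countable: "countable \<Lambda>"
    and lattice_subset_rvec: "\<Lambda> \<subseteq> rvec n"
    and lattice_zero: "vdiff n x x \<in> \<Lambda>"
    and lattice_uminus: "vdiff n x y \<in> \<Lambda> \<Longrightarrow> vdiff n y x \<in> \<Lambda>"
    and lattice_trans: "vdiff n x y \<in> \<Lambda> \<Longrightarrow> vdiff n y z \<in> \<Lambda> \<Longrightarrow> vdiff n x z \<in> \<Lambda>"
proof -
  obtain b where \<Lambda>: "\<Lambda> = range (\<lambda>k. lincomb n b (\<lambda>j. real_of_int (k j)))"
    using assms by (auto simp: is_lattice_def full_SetCompr_eq)
  have mem: "lincomb n b (\<lambda>j. real_of_int (k j)) \<in> \<Lambda>" for k by (auto simp: \<Lambda>)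
  \<comment> \<open>Integer coefficient functions on all naturals are uncountable in number. Only
    the values below \<open>n\<close> enter \<open>lincomb\<close>, so their restrictions
    suffice.\<close>
  have "\<Lambda> \<subseteq> (\<lambda>k. lincomb n b (\<lambda>j. real_of_int (k j))) ` ({..<n} \<rightarrow>\<^sub>E UNIV)"
  proof
    fix v assume "v \<in> \<Lambda>"
    then obtain k where "v = lincomb n b (\<lambda>j. real_of_int (k j))" by (auto simp: \<Lambda>)
    then have "v = lincomb n b (\<lambda>j. real_of_int (restrict k {..<n} j))"
      by (auto simp: lincomb_def fun_eq_iff intro!: sum.cong)
    then show "v \<in> (\<lambda>k. lincomb n b (\<lambda>j. real_of_int (k j))) ` ({..<n} \<rightarrow>\<^sub>E UNIV)"
      by (intro image_eqI[where x = "restrict k {..<n}"]) auto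
  qed
  moreover have "countable ({..<n} \<rightarrow>\<^sub>E (UNIV :: int set))" by (intro countable_PiE) auto
  ultimately show "countable \<Lambda>" by (meson countable_image countable_subset)
  show "\<Lambda> \<subseteq> rvec n" by (auto simp: \<Lambda> lincomb_def rvec_def split: if_splits)
  have "vdiff n x x = lincomb n b (\<lambda>j. real_of_int 0)"
    by (auto simp: vdiff_def lincomb_def)
  then show "vdiff n x x \<in> \<Lambda>" using mem[of "\<lambda>_. 0"] by simp
  show "vdiff n y x \<in> \<Lambda>" if "vdiff n x y \<in> \<Lambda>"
  proof -
    from that obtain k where k: "vdiff n x y = lincomb n b (\<lambda>j. real_of_int (k j))"
      by (auto simp: \<Lambda>)
    have "vdiff n y x = lincomb n b (\<lambda>j. real_of_int (- k j))"
      using fun_cong[OF k] by (auto simp: vdiff_def lincomb_def fun_eq_iff sum_negf)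
        (metis minus_diff_eq)
    then show ?thesis using mem[of "\<lambda>j. - k j"] by simp
  qed
  show "vdiff n x z \<in> \<Lambda>" if xy: "vdiff n x y \<in> \<Lambda>" and yz: "vdiff n y z \<in> \<Lambda>"
  proof -
    from xy obtain k where k: "vdiff n x y = lincomb n b (\<lambda>j. real_of_int (k j))"
      by (auto simp: \<Lambda>)
    from yz obtain l where l: "vdiff n y z = lincomb n b (\<lambda>j. real_of_int (l j))"
      by (auto simp: \<Lambda>)
    have "x i - z i = (\<Sum>j<n. (real_of_int (k j) + real_of_int (l j)) * b j i)" if "i < n" for i
      using fun_cong[OF k, of i] fun_cong[OF l, of i] that
      by (simp add: vdiff_def lincomb_def sum.distrib distrib_right)
    then have "vdiff n x z = lincomb n b (\<lambda>j. real_of_int (k j + l j))"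
      by (auto simp: vdiff_def lincomb_def fun_eq_iff)
    then show ?thesis using mem[of "\<lambda>j. k j + l j"] by simp
  qed
qed

lemma equiv_cong_rel:
  assumes "is_lattice n \<Lambda>"
  shows "equiv (rvec n) (cong_rel n \<Lambda>)"
proof (intro equivI refl_onI symI transI)
  fix x y z
  assume "(x, y) \<in> cong_rel n \<Lambda>" "(y, z) \<in> cong_rel n \<Lambda>"
  then show "(x, z) \<in> cong_rel n \<Lambda>"
    using lattice_trans[OF assms, of x y z] by (simp add: cong_rel_def)
qed (auto simp: cong_rel_def lattice_zero[OF assms] intro: lattice_uminus[OF assms])

lemma torus_proj_in_torus: "x \<in> rvec n \<Longrightarrow> torus_proj n \<Lambda> x \<in> torus n \<Lambda>"
  by (simp add: torus_def torus_proj_def quotientI)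

lemma mem_torus_proj_iff:
  "y \<in> torus_proj n \<Lambda> x \<longleftrightarrow> x \<in> rvec n \<and> y \<in> rvec n \<and> vdiff n x y \<in> \<Lambda>"
  by (auto simp: torus_proj_def cong_rel_def)

lemma torus_proj_eq_iff:
  assumes "is_lattice n \<Lambda>" "x \<in> rvec n" "y \<in> rvec n"
  shows "torus_proj n \<Lambda> x = torus_proj n \<Lambda> y \<longleftrightarrow> vdiff n x y \<in> \<Lambda>"
  using eq_equiv_class_iff[OF equiv_cong_rel[OF assms(1)] assms(2,3)] assms(2,3)
  by (simp add: torus_proj_def cong_rel_def)

lemma torus_eq_torus_proj:
  assumes "is_lattice n \<Lambda>" "t \<in> torus n \<Lambda>" "x \<in> t"
  shows "x \<in> rvec n" "t = torus_proj n \<Lambda> x"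
proof -
  obtain y where y: "y \<in> rvec n" "t = torus_proj n \<Lambda> y"
    using assms(2) by (auto simp: torus_def torus_proj_def quotient_def)
  show "x \<in> rvec n" using y assms(3) by (auto simp: mem_torus_proj_iff)
  then show "t = torus_proj n \<Lambda> x"
    using y assms(1,3) by (auto simp: mem_torus_proj_iff torus_proj_eq_iff)
qed

section \<open>Lebesgue measure of boxes and translation invariance\<close>

lemma measurable_vadd [measurable]:
  "(\<lambda>x. vadd n x p) \<in> lebesgue_measure n \<rightarrow>\<^sub>M lebesgue_measure n"
  unfolding vadd_def lebesgue_measure_def by measurable

lemma measurable_vdiff [measurable]:
  "(\<lambda>x. vdiff n x p) \<in> lebesgue_measure n \<rightarrow>\<^sub>M lebesgue_measure n"
  unfolding vdiff_def lebesgue_measure_def by measurable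

lemma box_in_sets_lebesgue_measure:
  "(\<And>i. i < n \<Longrightarrow> A i \<in> sets borel) \<Longrightarrow> PiE {..<n} A \<in> sets (lebesgue_measure n)"
  unfolding lebesgue_measure_def by (rule sets_PiM_I_finite) auto

lemma emeasure_lebesgue_box:
  assumes "\<And>i. i < n \<Longrightarrow> A i \<in> sets borel"
  shows "emeasure (lebesgue_measure n) (PiE {..<n} A) = (\<Prod>i<n. emeasure lborel (A i))"
proof -
  interpret product_sigma_finite "\<lambda>_::nat. lborel :: real measure" by unfold_locales
  show ?thesis using assms unfolding lebesgue_measure_def by (subst emeasure_PiM) auto
qed

text \<open>A product measure is determined by its values on boxes, and on a box the claim reduces
  to invariance of \<open>lborel\<close> in each coordinate.\<close>

lemma distr_lebesgue_measure_vadd: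
  "distr (lebesgue_measure n) (lebesgue_measure n) (\<lambda>x. vadd n x p) = lebesgue_measure n"
proof -
  interpret product_sigma_finite "\<lambda>_::nat. lborel :: real measure" by unfold_locales
  have "distr (lebesgue_measure n) (lebesgue_measure n) (\<lambda>x. vadd n x p)
      = Pi\<^sub>M {..<n} (\<lambda>_. lborel)"
  proof (rule PiM_eqI)
    fix A :: "nat \<Rightarrow> real set"
    assume A: "\<And>i. i \<in> {..<n} \<Longrightarrow> A i \<in> sets lborel"
    have preim: "(\<lambda>x. vadd n x p) -` PiE {..<n} A \<inter> space (lebesgue_measure n)
        = PiE {..<n} (\<lambda>i. (+) (p i) -` A i)"
      by (auto simp: space_lebesgue_measure rvec_def vadd_def PiE_iff add.commute)
    have shift: "emeasure lborel ((+) (p i) -` A i) = emeasure lborel (A i)" if "i < n" for i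
      using A[of i] that
      by (subst (2) lborel_distr_plus[of "p i", symmetric], subst emeasure_distr) auto
    have meas: "(+) (p i) -` A i \<in> sets borel" if "i < n" for i
      using A[of i] that measurable_sets[of "(+) (p i)" borel borel "A i"] by auto
    have "emeasure (distr (lebesgue_measure n) (lebesgue_measure n) (\<lambda>x. vadd n x p)) (PiE {..<n} A)
        = emeasure (lebesgue_measure n) (PiE {..<n} (\<lambda>i. (+) (p i) -` A i))"
      using A by (subst emeasure_distr) (auto simp: preim intro!: box_in_sets_lebesgue_measure)
    also have "\<dots> = (\<Prod>i<n. emeasure lborel (A i))"
      using meas shift by (subst emeasure_lebesgue_box) auto
    finally show "emeasure (distr (lebesgue_measure n) (lebesgue_measure n) (\<lambda>x. vadd n x p))
        (PiE {..<n} A) = (\<Prod>i\<in>{..<n}. emeasure lborel (A i))" by simp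
  qed (auto simp: lebesgue_measure_def)
  then show ?thesis by (simp add: lebesgue_measure_def)
qed

lemma emeasure_lebesgue_vadd_vimage:
  assumes "A \<in> sets (lebesgue_measure n)"
  shows "emeasure (lebesgue_measure n) ((\<lambda>x. vadd n x p) -` A \<inter> rvec n)
       = emeasure (lebesgue_measure n) A"
  using assms emeasure_distr[OF measurable_vadd assms, of p]
  by (simp add: distr_lebesgue_measure_vadd space_lebesgue_measure)

text \<open>Cut and reassemble: \<open>Q p\<close> collects the points of \<open>B\<close> whose
  representative in the fundamental domain \<open>F\<close> is obtained by subtracting
  \<open>p\<close>, and \<open>P p\<close> is \<open>Q p\<close> moved into \<open>F\<close>. The
  \<open>Q p\<close> are disjoint because \<open>F\<close> meets each class once, the
  \<open>P p\<close> because translates of \<open>L\<close> are disjoint. Translation invariance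
  equates the pieces, whichever \<open>F\<close> was chosen.\<close>

lemma
  assumes packing: "packing_lattice n \<Lambda> L"
    and B: "B \<in> sets (lebesgue_measure n)" "B \<subseteq> L"
  shows torus_proj_image_in_sets: "torus_proj n \<Lambda> ` B \<in> sets (torus_measure n \<Lambda>)"
    and emeasure_torus_proj_image:
      "emeasure (torus_measure n \<Lambda>) (torus_proj n \<Lambda> ` B) = emeasure (lebesgue_measure n) B"
proof -
  let ?lam = "lebesgue_measure n" and ?proj = "torus_proj n \<Lambda>"
  have lat: "is_lattice n \<Lambda>" using packing by (simp add: packing_lattice_def)
  define F where "F = (SOME F. fundamental_domain n \<Lambda> F)"
  have "fundamental_domain n \<Lambda> F"
    unfolding F_def by (rule someI_ex[OF fundamental_domain_exists[OF lat]])
  then have F: "F \<in> sets ?lam" and F_ex1: "\<And>t. t \<in> torus n \<Lambda> \<Longrightarrow> \<exists>!x. x \<in> t \<inter> F"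
    by (auto simp: fundamental_domain_def)
  have F_rvec: "F \<subseteq> rvec n" and B_rvec: "B \<subseteq> rvec n"
    using sets.sets_into_space[OF F] sets.sets_into_space[OF B(1)]
    by (simp_all add: space_lebesgue_measure)
  have F_inj: "x = y" if "x \<in> F" "y \<in> F" "z \<in> rvec n" "vdiff n z x \<in> \<Lambda>" "vdiff n z y \<in> \<Lambda>" for x y z
    using F_ex1[OF torus_proj_in_torus[OF that(3)]] that F_rvec
    by (auto simp: mem_torus_proj_iff)
  define \<A> where "\<A> = {S \<in> Pow (torus n \<Lambda>). ?proj -` S \<inter> rvec n \<in> sets ?lam}"
  have \<A>: "\<A> \<subseteq> Pow (torus n \<Lambda>)" by (auto simp: \<A>_def)
  have torus_measure: "torus_measure n \<Lambda> = distr (restrict_space ?lam F) (sigma (torus n \<Lambda>) \<A>) ?proj"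
    by (simp add: torus_measure_def \<A>_def F_def)
  \<comment> \<open>Saturating \<open>B\<close> under the lattice gives a countable union of
    translates, hence a measurable set. This is what membership in the quotient sigma-algebra asks
    for.\<close>
  have preimage: "?proj -` (?proj ` B) \<inter> rvec n = (\<Union>p\<in>\<Lambda>. (\<lambda>x. vadd n x p) -` B \<inter> rvec n)"
  proof (intro equalityI subsetI)
    fix x assume "x \<in> ?proj -` (?proj ` B) \<inter> rvec n"
    then obtain z where x: "x \<in> rvec n" and z: "z \<in> B" "?proj z = ?proj x" by auto
    then have "vdiff n z x \<in> \<Lambda>" using torus_proj_eq_iff[OF lat] B_rvec by blast
    moreover have "vadd n x (vdiff n z x) = z"
      using z B_rvec by (auto intro: vadd_vdiff_right)
    ultimately show "x \<in> (\<Union>p\<in>\<Lambda>. (\<lambda>x. vadd n x p) -` B \<inter> rvec n)"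
      using x z(1) by (metis IntI UN_I vimageI2)
  next
    fix x assume "x \<in> (\<Union>p\<in>\<Lambda>. (\<lambda>x. vadd n x p) -` B \<inter> rvec n)"
    then obtain p where p: "p \<in> \<Lambda>" "vadd n x p \<in> B" and x: "x \<in> rvec n" by auto
    have "vdiff n (vadd n x p) x = p"
      using p lattice_subset_rvec[OF lat] by (auto intro: vdiff_vadd_left)
    then have "?proj (vadd n x p) = ?proj x" using p x torus_proj_eq_iff[OF lat] by simp
    then show "x \<in> ?proj -` (?proj ` B) \<inter> rvec n" using p x by (metis IntI imageI vimageI)
  qed
  have translate_sets: "(\<lambda>x. vadd n x p) -` B \<inter> rvec n \<in> sets ?lam" for p
    using measurable_sets[OF measurable_vadd B(1)] by (simp add: space_lebesgue_measure)
  have "?proj -` (?proj ` B) \<inter> rvec n \<in> sets ?lam"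
    unfolding preimage using translate_sets lattice_countable[OF lat]
    by (intro sets.countable_UN') auto
  then have "?proj ` B \<in> \<A>" using B_rvec by (auto simp: \<A>_def torus_proj_in_torus)
  then have "?proj ` B \<in> sets (sigma (torus n \<Lambda>) \<A>)" using \<A> by auto
  then show image_sets: "?proj ` B \<in> sets (torus_measure n \<Lambda>)" by (simp add: torus_measure)
  have proj_meas: "?proj \<in> restrict_space ?lam F \<rightarrow>\<^sub>M sigma (torus n \<Lambda>) \<A>"
  proof (rule measurable_measure_of[OF \<A>])
    show "?proj \<in> space (restrict_space ?lam F) \<rightarrow> torus n \<Lambda>"
      by (auto simp: space_restrict_space space_lebesgue_measure torus_proj_in_torus)
    fix S assume "S \<in> \<A>"
    then have "?proj -` S \<inter> rvec n \<in> sets ?lam" by (simp add: \<A>_def)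
    moreover have "?proj -` S \<inter> space (restrict_space ?lam F) = F \<inter> (?proj -` S \<inter> rvec n)"
      by (auto simp: space_restrict_space space_lebesgue_measure)
    ultimately show "?proj -` S \<inter> space (restrict_space ?lam F) \<in> sets (restrict_space ?lam F)"
      by (auto simp: sets_restrict_space)
  qed
  define P where "P p = (\<lambda>x. vadd n x p) -` B \<inter> F" for p
  define Q where "Q p = {z \<in> B. vdiff n z p \<in> F}" for p
  have P_sets: "P p \<in> sets ?lam" for p
  proof -
    have "P p = ((\<lambda>x. vadd n x p) -` B \<inter> rvec n) \<inter> F" using F_rvec by (auto simp: P_def)
    then show ?thesis using translate_sets F by auto
  qed
  have Q_sets: "Q p \<in> sets ?lam" for p
  proof -
    have "Q p = B \<inter> ((\<lambda>x. vdiff n x p) -` F \<inter> space ?lam)"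
      using B_rvec by (auto simp: Q_def space_lebesgue_measure)
    then show ?thesis using B(1) measurable_sets[OF measurable_vdiff F] by auto
  qed
  have P_Q: "emeasure ?lam (P p) = emeasure ?lam (Q p)" for p
  proof -
    have "P p = (\<lambda>x. vadd n x p) -` Q p \<inter> rvec n"
      using F_rvec by (auto simp: P_def Q_def vdiff_vadd_cancel)
    then show ?thesis using emeasure_lebesgue_vadd_vimage[OF Q_sets] by simp
  qed
  have P_disj: "disjoint_family_on P \<Lambda>"
  proof (unfold disjoint_family_on_def, intro ballI impI, rule ccontr)
    fix p q assume pq: "p \<in> \<Lambda>" "q \<in> \<Lambda>" "p \<noteq> q" "P p \<inter> P q \<noteq> {}"
    then obtain x where x: "vadd n x p \<in> B" "vadd n x q \<in> B" by (auto simp: P_def)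
    \<comment> \<open>The point x + p + q is in L + q because x + p is in B, and in L + p because x
      + q is in B.\<close>
    have "vadd n (vadd n x p) q \<in> (\<lambda>x. vadd n x q) ` L"
      using x(1) B(2) by auto
    moreover have "vadd n (vadd n x p) q = vadd n (vadd n x q) p" by (auto simp: vadd_def)
    then have "vadd n (vadd n x p) q \<in> (\<lambda>x. vadd n x p) ` L"
      using x(2) B(2) by auto
    ultimately have "(\<lambda>x. vadd n x p) ` L \<inter> (\<lambda>x. vadd n x q) ` L \<noteq> {}" by blast
    then show False using packing pq unfolding packing_lattice_def disjoint_family_on_def by blast
  qed
  have Q_disj: "disjoint_family_on Q \<Lambda>"
  proof (unfold disjoint_family_on_def, intro ballI impI, rule ccontr)
    fix p q assume pq: "p \<in> \<Lambda>" "q \<in> \<Lambda>" "p \<noteq> q" "Q p \<inter> Q q \<noteq> {}"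
    then obtain z where z: "z \<in> B" "vdiff n z p \<in> F" "vdiff n z q \<in> F" by (auto simp: Q_def)
    have p: "vdiff n z (vdiff n z p) = p" "vdiff n z (vdiff n z q) = q"
      using pq lattice_subset_rvec[OF lat] by (auto intro!: vdiff_vdiff_cancel)
    then have "vdiff n z p = vdiff n z q" using F_inj[OF z(2,3), of z] z B_rvec pq by auto
    then show False using p pq by metis
  qed
  have Q_Un: "(\<Union>p\<in>\<Lambda>. Q p) = B"
  proof (intro equalityI subsetI)
    fix z assume z: "z \<in> B"
    then obtain x where x: "x \<in> ?proj z" "x \<in> F"
      using F_ex1[OF torus_proj_in_torus, of z] B_rvec by blast
    then have "vdiff n z x \<in> \<Lambda>" "vdiff n z (vdiff n z x) \<in> F"
      using F_rvec by (auto simp: mem_torus_proj_iff vdiff_vdiff_cancel)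
    then show "z \<in> (\<Union>p\<in>\<Lambda>. Q p)" using z by (auto simp: Q_def)
  qed (auto simp: Q_def)
  have "emeasure (torus_measure n \<Lambda>) (?proj ` B)
      = emeasure (restrict_space ?lam F) (?proj -` (?proj ` B) \<inter> space (restrict_space ?lam F))"
    unfolding torus_measure by (rule emeasure_distr[OF proj_meas]) (use image_sets torus_measure in simp)
  also have "?proj -` (?proj ` B) \<inter> space (restrict_space ?lam F) = (?proj -` (?proj ` B) \<inter> rvec n) \<inter> F"
    by (auto simp: space_restrict_space space_lebesgue_measure)
  also have "\<dots> = (\<Union>p\<in>\<Lambda>. P p)"
    unfolding preimage using F_rvec by (auto simp: P_def)
  also have "emeasure (restrict_space ?lam F) (\<Union>p\<in>\<Lambda>. P p) = emeasure ?lam (\<Union>p\<in>\<Lambda>. P p)"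
    using F by (intro emeasure_restrict_space) (auto simp: P_def)
  \<comment> \<open>Both disjoint unions become sums over the countable lattice, so that pieces can
    be exchanged one by one.\<close>
  also have "\<dots> = (\<integral>\<^sup>+p. emeasure ?lam (P p) \<partial>count_space \<Lambda>)"
    using P_sets P_disj lattice_countable[OF lat] by (intro emeasure_UN_countable) auto
  also have "\<dots> = (\<integral>\<^sup>+p. emeasure ?lam (Q p) \<partial>count_space \<Lambda>)" by (simp add: P_Q)
  also have "\<dots> = emeasure ?lam (\<Union>p\<in>\<Lambda>. Q p)"
    using Q_sets Q_disj lattice_countable[OF lat] by (intro emeasure_UN_countable[symmetric]) auto
  finally show "emeasure (torus_measure n \<Lambda>) (?proj ` B) = emeasure ?lam B" by (simp add: Q_Un)
qed

lemma space_torus_measure: "space (torus_measure n \<Lambda>) = torus n \<Lambda>"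
  unfolding torus_measure_def by (subst space_distr, subst space_measure_of) auto

section \<open>Unit boxes around test points\<close>

text \<open>This is x + C_n. As C_n is symmetric, it is also x - C_n, the set of centres from which
  a cube covers x.\<close>

definition closed_box :: "nat \<Rightarrow> (nat \<Rightarrow> real) \<Rightarrow> (nat \<Rightarrow> real) set" where
  "closed_box n x = (\<Pi>\<^sub>E i\<in>{..<n}. {x i - 1/2..x i + 1/2})"

lemma closed_box_in_sets: "closed_box n x \<in> sets (lebesgue_measure n)"
  unfolding closed_box_def by (rule box_in_sets_lebesgue_measure) auto

text \<open>The overlap is again a box, and two unit intervals whose centres are at distance d \<le>
  1 overlap in length 1 - d.\<close>

lemma emeasure_closed_box_Int:
  assumes "\<And>i. i < n \<Longrightarrow> \<bar>x i - y i\<bar> \<le> 1"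
  shows "emeasure (lebesgue_measure n) (closed_box n x \<inter> closed_box n y)
       = ennreal (\<Prod>i<n. 1 - \<bar>x i - y i\<bar>)"
proof -
  have "closed_box n x \<inter> closed_box n y
      = (\<Pi>\<^sub>E i\<in>{..<n}. {max (x i) (y i) - 1/2..min (x i) (y i) + 1/2})"
    unfolding closed_box_def PiE_Int by (intro PiE_cong) auto
  moreover have "emeasure lborel {max (x i) (y i) - 1/2..min (x i) (y i) + 1/2}
      = ennreal (1 - \<bar>x i - y i\<bar>)" if "i < n" for i
    using assms[OF that] by (auto simp: max_def min_def abs_if)
  ultimately show ?thesis
    using assms by (simp add: emeasure_lebesgue_box) (subst prod_ennreal, auto)
qed

lemma measure_closed_box: "measure (lebesgue_measure n) (closed_box n x) = 1"
  using emeasure_closed_box_Int[of n x x] by (simp add: measure_def)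

lemma measure_closed_box_Un:
  assumes "\<And>i. i < n \<Longrightarrow> \<bar>x i - y i\<bar> \<le> 1"
  shows "measure (lebesgue_measure n) (closed_box n x \<union> closed_box n y)
       = 2 - (\<Prod>i<n. 1 - \<bar>x i - y i\<bar>)"
proof -
  have "closed_box n z \<in> fmeasurable (lebesgue_measure n)" for z
    using closed_box_in_sets emeasure_closed_box_Int[of n z z] by (intro fmeasurableI) auto
  moreover have "0 \<le> (\<Prod>i<n. 1 - \<bar>x i - y i\<bar>)" using assms by (intro prod_nonneg) simp
  then have "measure (lebesgue_measure n) (closed_box n x \<inter> closed_box n y)
      = (\<Prod>i<n. 1 - \<bar>x i - y i\<bar>)"
    using emeasure_closed_box_Int[OF assms] by (simp add: measure_def)
  ultimately show ?thesis by (simp add: measure_Un3 measure_closed_box)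
qed

text \<open>If a + c is congruent to x, then a is congruent to x - c, which lies in the box around x
  by symmetry of the cube. The class of a would then be a point of \<open>A\<close> in the image of
  that box.\<close>

lemma uncovered_if_disjoint:
  assumes lat: "is_lattice n \<Lambda>" and A: "A \<subseteq> torus n \<Lambda>" and x: "x \<in> rvec n"
    and disj: "A \<inter> torus_proj n \<Lambda> ` closed_box n x = {}"
  shows "torus_proj n \<Lambda> x \<notin> torus_plus n \<Lambda> A (cube n)"
proof
  assume "torus_proj n \<Lambda> x \<in> torus_plus n \<Lambda> A (cube n)"
  then obtain a c t where t: "t \<in> A" "a \<in> t" and c: "c \<in> cube n"
    and eq: "torus_proj n \<Lambda> x = torus_proj n \<Lambda> (vadd n a c)"
    by (auto simp: torus_plus_def)
  have a: "a \<in> rvec n" "t = torus_proj n \<Lambda> a"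
    using torus_eq_torus_proj[OF lat] t A by auto
  have "vdiff n x (vadd n a c) \<in> \<Lambda>" using eq torus_proj_eq_iff[OF lat x] by simp
  moreover have "vdiff n x (vadd n a c) = vdiff n (vdiff n x c) a"
    by (rule rvec_eqI[OF vdiff_in_rvec vdiff_in_rvec]) (simp add: vdiff_def vadd_def)
  ultimately have "torus_proj n \<Lambda> (vdiff n x c) = t"
    using torus_proj_eq_iff[OF lat, of "vdiff n x c" a] a by simp
  moreover have "-1/2 \<le> c i \<and> c i \<le> 1/2" if "i < n" for i
    using PiE_mem[OF c[unfolded cube_def], of i] that by simp
  then have "vdiff n x c \<in> closed_box n x"
    unfolding closed_box_def vdiff_def restrict_PiE_iff by fastforce
  ultimately show False using t disj by blast
qed

subsection \<open>The second moment bound\<close>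

text \<open>Chebyshev's inequality for the number \<open>Z\<close> of events that occur: when none
  occurs, \<open>Z\<close> deviates from its mean \<open>s\<close> by exactly \<open>s\<close>, so
  s^2 times the probability of this is at most the variance.\<close>

lemma (in prob_space) prob_none_le_second_moment:
  fixes A :: "'i \<Rightarrow> 'a set"
  assumes "finite I" "\<And>i. i \<in> I \<Longrightarrow> A i \<in> events" "0 < (\<Sum>i\<in>I. prob (A i))"
  shows "prob (space M - (\<Union>i\<in>I. A i))
       \<le> (\<Sum>i\<in>I. \<Sum>j\<in>I. prob (A i \<inter> A j)) / (\<Sum>i\<in>I. prob (A i))\<^sup>2 - 1"
proof -
  define s where "s = (\<Sum>i\<in>I. prob (A i))"
  define Z where "Z x = (\<Sum>i\<in>I. indicator (A i) x :: real)" for x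
  let ?E = "space M - (\<Union>i\<in>I. A i)"
  have E: "?E \<in> events" using assms by (intro sets.Diff sets.finite_UN) auto
  have int: "integrable M (\<lambda>x. indicator (B :: 'a set) x :: real)" if "B \<in> events" for B
    using that by (simp add: integrable_indicator_iff emeasure_eq_measure)
  have "integrable M Z"
    unfolding Z_def[abs_def] by (intro Bochner_Integration.integrable_sum int assms(2))
  moreover have "expectation Z = s"
    unfolding Z_def[abs_def] s_def using assms(2)
    by (subst Bochner_Integration.integral_sum) (auto intro: int)
  ultimately have Z: "integrable M Z" "expectation Z = s" .
  have Z2_eq: "(Z x)\<^sup>2 = (\<Sum>i\<in>I. \<Sum>j\<in>I. indicator (A i \<inter> A j) x)" for x
    by (simp add: Z_def power2_eq_square sum_product indicator_inter_arith)
  have "integrable M (\<lambda>x. (Z x)\<^sup>2)"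
    unfolding Z2_eq by (intro Bochner_Integration.integrable_sum int sets.Int assms(2))
  moreover have "expectation (\<lambda>x. (Z x)\<^sup>2) = (\<Sum>i\<in>I. \<Sum>j\<in>I. prob (A i \<inter> A j))"
  proof -
    have "expectation (\<lambda>x. (Z x)\<^sup>2)
        = (\<Sum>i\<in>I. \<Sum>j\<in>I. expectation (\<lambda>x. indicator (A i \<inter> A j) x))"
      unfolding Z2_eq using assms(2)
      by (subst Bochner_Integration.integral_sum,
          (intro Bochner_Integration.integrable_sum int sets.Int; simp),
          intro sum.cong refl Bochner_Integration.integral_sum int sets.Int) auto
    then show ?thesis using assms(2) by simp
  qed
  ultimately have Z2: "integrable M (\<lambda>x. (Z x)\<^sup>2)"
    "expectation (\<lambda>x. (Z x)\<^sup>2) = (\<Sum>i\<in>I. \<Sum>j\<in>I. prob (A i \<inter> A j))" .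
  have "s\<^sup>2 * prob ?E = expectation (\<lambda>x. s\<^sup>2 * indicator ?E x)" using E by simp
  also have "\<dots> \<le> expectation (\<lambda>x. (Z x - s)\<^sup>2)"
  proof (rule integral_mono)
    show "integrable M (\<lambda>x. (Z x - s)\<^sup>2)" using Z Z2 by (simp add: power2_diff)
    show "s\<^sup>2 * indicator ?E x \<le> (Z x - s)\<^sup>2" for x
    proof (cases "x \<in> ?E")
      case True
      then have "Z x = 0" by (auto simp: Z_def intro!: sum.neutral)
      then show ?thesis using True by simp
    next
      case False
      then have "indicator ?E x = (0 :: real)" by (rule indicator_simps)
      then show ?thesis by simp
    qed
  qed (use E in \<open>simp add: integrable_indicator_iff emeasure_eq_measure\<close>)
  also have "\<dots> = expectation (\<lambda>x. (Z x)\<^sup>2) - 2 * s * s + s\<^sup>2"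
    using Z Z2(1) by (simp add: power2_diff prob_space)
  also have "\<dots> = (\<Sum>i\<in>I. \<Sum>j\<in>I. prob (A i \<inter> A j)) - s\<^sup>2"
    unfolding Z2(2) by (simp add: power2_eq_square)
  finally show ?thesis using assms(3) by (simp add: s_def[symmetric] field_simps)
qed

section \<open>Discrete analogues of power integrals\<close>

text \<open>The difference of powers factors into a sum of k + 1 products, each between
  \<open>x ^ k\<close> and \<open>(x + 1) ^ k\<close>. Telescoping these bounds compares power sums
  with integrals.\<close>

lemma power_Suc_diff_bounds:
  fixes x :: real
  assumes "0 \<le> x"
  shows "real (Suc k) * x ^ k \<le> (x + 1) ^ Suc k - x ^ Suc k"
    and "(x + 1) ^ Suc k - x ^ Suc k \<le> real (Suc k) * (x + 1) ^ k"
proof -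
  have eq: "(x + 1) ^ Suc k - x ^ Suc k = (\<Sum>p<Suc k. (x + 1) ^ p * x ^ (k - p))"
    using diff_power_eq_sum[of "x + 1" k x] by simp
  have "(\<Sum>p<Suc k. x ^ k) \<le> (\<Sum>p<Suc k. (x + 1) ^ p * x ^ (k - p))"
  proof (rule sum_mono)
    fix p assume "p \<in> {..<Suc k}"
    then have "x ^ k = x ^ p * x ^ (k - p)" by (simp add: power_add[symmetric])
    then show "x ^ k \<le> (x + 1) ^ p * x ^ (k - p)"
      using assms by (auto intro!: mult_right_mono power_mono)
  qed
  then show "real (Suc k) * x ^ k \<le> (x + 1) ^ Suc k - x ^ Suc k" by (simp only: eq) simp
  have "(\<Sum>p<Suc k. (x + 1) ^ p * x ^ (k - p)) \<le> (\<Sum>p<Suc k. (x + 1) ^ k)"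
  proof (rule sum_mono)
    fix p assume "p \<in> {..<Suc k}"
    then have "(x + 1) ^ k = (x + 1) ^ p * (x + 1) ^ (k - p)" by (simp add: power_add[symmetric])
    then show "(x + 1) ^ p * x ^ (k - p) \<le> (x + 1) ^ k"
      using assms by (auto intro!: mult_left_mono power_mono)
  qed
  then show "(x + 1) ^ Suc k - x ^ Suc k \<le> real (Suc k) * (x + 1) ^ k" by (simp only: eq) simp
qed

lemma sum_shifted_powers_le:
  fixes x :: real
  assumes "0 \<le> x"
  shows "real (Suc k) * (\<Sum>b<a. (x + real b) ^ k) \<le> (x + real a) ^ Suc k - x ^ Suc k"
proof (induction a)
  case (Suc a)
  then show ?case
    using power_Suc_diff_bounds(1)[of "x + real a" k] assms
    by (simp add: algebra_simps)
qed simp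

lemma sum_Suc_powers_ge: "real m ^ Suc k \<le> real (Suc k) * (\<Sum>i<m. real (Suc i) ^ k)"
proof (induction m)
  case (Suc m)
  then show ?case
    using power_Suc_diff_bounds(2)[of "real m" k] by (simp add: algebra_simps)
qed simp

text \<open>Discrete form of the integral of (1 - a + b)^k over 0 \<le> b \<le> a \<le> 1, which is
  1/(k+2). The inner sums telescope from above; the sum \<open>?T\<close> subtracted afterwards is
  bounded from below, so no error term is left.\<close>

lemma sum_triangle_powers_le:
  "(\<Sum>a<m. \<Sum>b<a. (real m - real a + real b) ^ k) \<le> real m ^ (k + 2) / real (k + 2)"
proof -
  let ?T = "\<Sum>a<m. (real m - real a) ^ Suc k"
  have "?T = (\<Sum>i<m. real (Suc i) ^ Suc k)"
    by (subst sum.nat_diff_reindex[symmetric]) (auto intro!: sum.cong simp: of_nat_diff)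
  then have T: "real m ^ (k + 2) / real (k + 2) \<le> ?T"
    using sum_Suc_powers_ge[of m "Suc k"] by (simp add: divide_le_eq mult.commute)
  have "real (Suc k) * (\<Sum>a<m. \<Sum>b<a. (real m - real a + real b) ^ k)
      = (\<Sum>a<m. real (Suc k) * (\<Sum>b<a. (real m - real a + real b) ^ k))"
    by (simp add: sum_distrib_left)
  also have "\<dots> \<le> (\<Sum>a<m. real m ^ Suc k - (real m - real a) ^ Suc k)"
    using sum_shifted_powers_le[of "real m - real a" k a for a] by (intro sum_mono) auto
  also have "\<dots> = real m ^ (k + 2) - ?T" by (simp add: sum_subtractf)
  also have "\<dots> \<le> real m ^ (k + 2) - real m ^ (k + 2) / real (k + 2)" using T by simp
  \<comment> \<open>Since 1 - 1/(k+2) = (k+1)/(k+2), the factor k + 1 from the inner sums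
    cancels.\<close>
  also have "\<dots> = real (Suc k) * (real m ^ (k + 2) / real (k + 2))"
    by (simp add: field_simps)
  finally show ?thesis by (rule mult_left_le_imp_le) simp
qed

text \<open>The D_k of the outline: the k-th moment of the overlap length of two unit intervals
  whose centres are independent uniform points of a grid of \<open>m\<close> points with spacing
  1/m.\<close>

definition overlap_moment :: "nat \<Rightarrow> nat \<Rightarrow> real" where
  "overlap_moment m k = (\<Sum>a<m. \<Sum>b<m. (1 - \<bar>real a - real b\<bar> / real m) ^ k) / real m ^ 2"

lemma overlap_moment_nonneg: "0 \<le> overlap_moment m k"
  unfolding overlap_moment_def
  by (intro divide_nonneg_nonneg sum_nonneg zero_le_power) (auto simp: divide_le_eq_1)

text \<open>The \<open>m\<close> diagonal pairs, each of weight 1, contribute 1/m after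
  normalization; the two triangles off the diagonal are equal by symmetry and contribute at most
  1/(k+2) each.\<close>

lemma overlap_moment_le:
  assumes "m > 0"
  shows "overlap_moment m k \<le> 1 / real m + 2 / real (k + 2)"
proof -
  let ?w = "\<lambda>a b. (1 - \<bar>real a - real b\<bar> / real m) ^ k"
  let ?L = "\<Sum>a<m. \<Sum>b<a. ?w a b"
  have split: "(\<Sum>b<m. ?w a b) = (\<Sum>b<a. ?w a b) + 1 + (\<Sum>b\<in>{a<..<m}. ?w a b)" if "a < m" for a
  proof -
    have eq: "{..<m} = {..<a} \<union> insert a {a<..<m}" using that by auto
    have "(\<Sum>b<m. ?w a b) = (\<Sum>b<a. ?w a b) + (\<Sum>b\<in>insert a {a<..<m}. ?w a b)"
      unfolding eq by (rule sum.union_disjoint) auto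
    then show ?thesis by simp
  qed
  have "(\<Sum>a<m. \<Sum>b\<in>{a<..<m}. ?w a b) = ?L"
  proof -
    \<comment> \<open>Turning the dependent range into a condition lets both sums run over
      \<open>{..<m}\<close>, so they can be swapped.\<close>
    have "(\<Sum>a<m. \<Sum>b\<in>{a<..<m}. ?w a b) = (\<Sum>a<m. \<Sum>b<m. if a < b then ?w a b else 0)"
      by (rule sum.cong[OF refl], rule sum.mono_neutral_cong_left) auto
    also have "\<dots> = (\<Sum>b<m. \<Sum>a<m. if a < b then ?w a b else 0)" by (rule sum.swap)
    also have "\<dots> = ?L"
      by (rule sum.cong[OF refl], rule sum.mono_neutral_cong_right) (auto simp: abs_minus_commute)
    finally show ?thesis .
  qed
  then have "(\<Sum>a<m. \<Sum>b<m. ?w a b) = real m + 2 * ?L"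
    using split by (simp add: sum.distrib)
  moreover have "?L = (\<Sum>a<m. \<Sum>b<a. (real m - real a + real b) ^ k) / real m ^ k"
  proof -
    have "1 - \<bar>real a - real b\<bar> / real m = (real m - real a + real b) / real m" if "b < a" for a b
      using assms that by (simp add: field_simps)
    then show ?thesis by (simp add: sum_divide_distrib power_divide)
  qed
  moreover have "\<dots> \<le> (real m ^ (k + 2) / real (k + 2)) / real m ^ k"
    by (intro divide_right_mono sum_triangle_powers_le) auto
  moreover have "(real m ^ (k + 2) / real (k + 2)) / real m ^ k = real m ^ 2 / real (k + 2)"
    using assms by (simp add: power_add power2_eq_square)
  ultimately have "(\<Sum>a<m. \<Sum>b<m. ?w a b) \<le> real m + 2 * (real m ^ 2 / real (k + 2))" by linarith
  then have "overlap_moment m k \<le> (real m + 2 * (real m ^ 2 / real (k + 2))) / real m ^ 2"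
    unfolding overlap_moment_def by (intro divide_right_mono) auto
  also have "\<dots> = 1 / real m + 2 / real (k + 2)"
    using assms by (simp add: add_divide_distrib power2_eq_square)
  finally show ?thesis .
qed

text \<open>The power distributes over the product, so each grid sum factors over the coordinates;
  \<open>real m ^ 2\<close> undoes the normalization of the moment.\<close>

lemma sum_grid_prod_powers:
  assumes "m > 0"
  shows "(\<Sum>x\<in>{..<n} \<rightarrow>\<^sub>E {..<m}. \<Sum>y\<in>{..<n} \<rightarrow>\<^sub>E {..<m}.
            (\<Prod>i<n. 1 - \<bar>real (x i) - real (y i)\<bar> / real m) ^ k)
         = (real m ^ 2 * overlap_moment m k) ^ n"
proof -
  let ?w = "\<lambda>a b. (1 - \<bar>real a - real b\<bar> / real m) ^ k"
  have "(\<Sum>x\<in>{..<n} \<rightarrow>\<^sub>E {..<m}. \<Sum>y\<in>{..<n} \<rightarrow>\<^sub>E {..<m}. \<Prod>i<n. ?w (x i) (y i))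
      = (\<Sum>x\<in>{..<n} \<rightarrow>\<^sub>E {..<m}. \<Prod>i<n. \<Sum>b<m. ?w (x i) b)"
    by (intro sum.cong refl prod_sum_PiE[symmetric]) auto
  also have "\<dots> = (\<Prod>i<n. \<Sum>a<m. \<Sum>b<m. ?w a b)"
    by (intro prod_sum_PiE[symmetric]) auto
  also have "\<dots> = (real m ^ 2 * overlap_moment m k) ^ n"
    using assms by (simp add: overlap_moment_def)
  finally show ?thesis by (simp add: prod_power_distrib)
qed

lemma sum_grid_exp:
  assumes "m > 0"
  shows "(\<lambda>k. \<rho> ^ Suc k / fact (Suc k) * overlap_moment m (Suc k) ^ n) sums
     ((\<Sum>x\<in>{..<n} \<rightarrow>\<^sub>E {..<m}. \<Sum>y\<in>{..<n} \<rightarrow>\<^sub>E {..<m}.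
        exp (\<rho> * (\<Prod>i<n. 1 - \<bar>real (x i) - real (y i)\<bar> / real m))) / (real m ^ n) ^ 2 - 1)"
proof -
  let ?G = "{..<n} \<rightarrow>\<^sub>E {..<m}"
  let ?p = "\<lambda>x y. \<Prod>i<n. 1 - \<bar>real (x i) - real (y i)\<bar> / real m"
  have "(\<lambda>k. (\<Sum>x\<in>?G. \<Sum>y\<in>?G. (\<rho> * ?p x y) ^ k /\<^sub>R fact k) / (real m ^ n) ^ 2) sums
    ((\<Sum>x\<in>?G. \<Sum>y\<in>?G. exp (\<rho> * ?p x y)) / (real m ^ n) ^ 2)"
    by (intro sums_divide sums_sum exp_converges)
  moreover have "(\<Sum>x\<in>?G. \<Sum>y\<in>?G. (\<rho> * ?p x y) ^ k /\<^sub>R fact k) / (real m ^ n) ^ 2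
      = \<rho> ^ k / fact k * overlap_moment m k ^ n" for k
  proof -
    have "(\<Sum>x\<in>?G. \<Sum>y\<in>?G. (\<rho> * ?p x y) ^ k /\<^sub>R fact k)
        = \<rho> ^ k / fact k * (\<Sum>x\<in>?G. \<Sum>y\<in>?G. ?p x y ^ k)"
      by (simp add: sum_distrib_left power_mult_distrib divide_inverse mult_ac)
    then show ?thesis using assms
      by (simp add: sum_grid_prod_powers power_mult_distrib power_mult[symmetric] mult.commute)
  qed
  ultimately have *: "(\<lambda>k. \<rho> ^ k / fact k * overlap_moment m k ^ n) sums
    ((\<Sum>x\<in>?G. \<Sum>y\<in>?G. exp (\<rho> * ?p x y)) / (real m ^ n) ^ 2)" by simp
  \<comment> \<open>The term of index 0 is therefore 1; splitting it off accounts for both the index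
    \<open>Suc k\<close> and the subtracted 1.\<close>
  have "overlap_moment m 0 = 1" using assms by (simp add: overlap_moment_def power2_eq_square)
  then show ?thesis using * by (subst sums_Suc_iff) simp
qed

section \<open>From covering probability to a grid average\<close>

lemma cover_prob_le:
  assumes packing: "packing_lattice n \<Lambda> (minkowski_diff n (cube n) (cube n))"
    and pp: "poisson_process M X (torus_measure n \<Lambda>) \<rho>"
    and m: "m > 0"
  shows "measure M {\<omega> \<in> space M. torus n \<Lambda> \<subseteq> torus_plus n \<Lambda> (X \<omega>) (cube n)}
       \<le> (\<Sum>x\<in>{..<n} \<rightarrow>\<^sub>E {..<m}. \<Sum>y\<in>{..<n} \<rightarrow>\<^sub>E {..<m}.
            exp (\<rho> * (\<Prod>i<n. 1 - \<bar>real (x i) - real (y i)\<bar> / real m))) / (real m ^ n) ^ 2 - 1"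
    (is "measure M ?C \<le> _")
proof -
  interpret prob_space M using pp by (simp add: poisson_process_def)
  let ?G = "{..<n} \<rightarrow>\<^sub>E {..<m}"
  let ?p = "\<lambda>x y. \<Prod>i<n. 1 - \<bar>real (x i) - real (y i)\<bar> / real m"
  let ?T = "torus_measure n \<Lambda>"
  have lat: "is_lattice n \<Lambda>" using packing by (simp add: packing_lattice_def)
  have X: "finite (X \<omega>)" "X \<omega> \<subseteq> torus n \<Lambda>" if "\<omega> \<in> space M" for \<omega>
    using pp that by (auto simp: poisson_process_def space_torus_measure)
  have meas: "(\<lambda>\<omega>. card (X \<omega> \<inter> S)) \<in> M \<rightarrow>\<^sub>M count_space UNIV"
    and void: "prob {\<omega> \<in> space M. card (X \<omega> \<inter> S) = 0} = exp (- (\<rho> * measure ?T S))"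
    if "S \<in> sets ?T" for S
    using pp that by (auto simp: poisson_process_def)
  \<comment> \<open>Grid of spacing 1/m in the half-open cube of side 1 centred at 0: the unit boxes
    around these points stay in [-1,1]^n, where projection to the torus preserves volume.\<close>
  define pt where "pt a = (\<lambda>i\<in>{..<n}. real (a i) / real m - 1/2)" for a :: "nat \<Rightarrow> nat"
  define S where "S a = torus_proj n \<Lambda> ` closed_box n (pt a)" for a
  \<comment> \<open>The event that test point \<open>a\<close> has no process point in its box. As
    samples are finite, count 0 does mean an empty intersection.\<close>
  define A where "A a = {\<omega> \<in> space M. card (X \<omega> \<inter> S a) = 0}" for a
  have G_less: "a i < m" if "a \<in> ?G" "i < n" for a i using that by auto
  have box_subset: "closed_box n (pt a) \<subseteq> minkowski_diff n (cube n) (cube n)" if "a \<in> ?G" for a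
  proof -
    have "0 \<le> real (a i) / real m \<and> real (a i) / real m \<le> 1" if "i < n" for i
      using G_less[OF \<open>a \<in> ?G\<close> that] m by (simp add: divide_le_eq)
    then have "{pt a i - 1/2..pt a i + 1/2} \<subseteq> {-1..1}" if "i < n" for i
      using that by (auto simp: pt_def)
    then show ?thesis unfolding minkowski_diff_cube closed_box_def by (intro PiE_mono) auto
  qed
  have S_sets: "S a \<in> sets ?T" if "a \<in> ?G" for a
    unfolding S_def by (rule torus_proj_image_in_sets[OF packing closed_box_in_sets box_subset[OF that]])
  have A_sets: "A a \<in> events" if "a \<in> ?G" for a
    using measurable_sets[OF meas[OF S_sets[OF that]], of "{0}"]
    by (simp add: A_def vimage_def Int_def conj_commute)
  have prob_A: "prob (A a) = exp (- \<rho>)" if "a \<in> ?G" for a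
    using void[OF S_sets[OF that]]
      emeasure_torus_proj_image[OF packing closed_box_in_sets box_subset[OF that]]
      measure_closed_box[of n "pt a"]
    by (simp add: A_def S_def measure_def)
  have prob_AA: "prob (A a \<inter> A b) = exp (- \<rho>) ^ 2 * exp (\<rho> * ?p a b)"
    if ab: "a \<in> ?G" "b \<in> ?G" for a b
  proof -
    \<comment> \<open>Two boxes are both empty exactly when their union is, so the joint probability
      is again a void probability, with volume 2 minus the overlap.\<close>
    have "A a \<inter> A b = {\<omega> \<in> space M. card (X \<omega> \<inter> (S a \<union> S b)) = 0}"
      using X(1) by (auto simp: A_def)
    then have "prob (A a \<inter> A b) = exp (- (\<rho> * measure ?T (S a \<union> S b)))"
      using void[of "S a \<union> S b"] S_sets ab by simp
    also have "measure ?T (S a \<union> S b)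
        = measure (lebesgue_measure n) (closed_box n (pt a) \<union> closed_box n (pt b))"
      unfolding S_def image_Un[symmetric] measure_def using box_subset[OF ab(1)] box_subset[OF ab(2)]
      by (subst emeasure_torus_proj_image[OF packing]) (auto intro: closed_box_in_sets)
    also have "\<dots> = 2 - ?p a b"
    proof -
      have eq: "\<bar>pt a i - pt b i\<bar> = \<bar>real (a i) - real (b i)\<bar> / real m" if "i < n" for i
        using that by (simp add: pt_def diff_divide_distrib[symmetric])
      have "\<bar>pt a i - pt b i\<bar> \<le> 1" if "i < n" for i
        using G_less[OF ab(1) that] G_less[OF ab(2) that] m that by (simp add: eq divide_le_eq)
      from measure_closed_box_Un[OF this] show ?thesis by (simp add: eq)
    qed
    finally show ?thesis
      by (simp add: exp_add[symmetric] power2_eq_square algebra_simps)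
  qed
  have card_G: "card ?G = m ^ n" by (simp add: card_PiE)
  have "?C \<subseteq> space M - (\<Union>a\<in>?G. A a)"
  proof (intro subsetI DiffI notI)
    fix \<omega> assume \<omega>: "\<omega> \<in> ?C" and "\<omega> \<in> (\<Union>a\<in>?G. A a)"
    then obtain a where a: "\<omega> \<in> A a" by blast
    have pt: "pt a \<in> rvec n" by (auto simp: pt_def rvec_def)
    have "X \<omega> \<inter> S a = {}" using a X(1)[of \<omega>] by (auto simp: A_def)
    then have "torus_proj n \<Lambda> (pt a) \<notin> torus_plus n \<Lambda> (X \<omega>) (cube n)"
      using uncovered_if_disjoint[OF lat X(2) pt, of \<omega>] \<omega> by (simp add: S_def)
    then show False using \<omega> torus_proj_in_torus[OF pt] by blast
  qed simp
  moreover have "space M - (\<Union>a\<in>?G. A a) \<in> events"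
    using A_sets by (intro sets.Diff sets.finite_UN) (auto intro: finite_PiE)
  \<comment> \<open>Monotonicity asks for measurability of the larger set; a nonmeasurable
    \<open>?C\<close> would have measure 0 by convention.\<close>
  ultimately have "prob ?C \<le> prob (space M - (\<Union>a\<in>?G. A a))"
    by (rule finite_measure_mono)
  also have "\<dots> \<le> (\<Sum>a\<in>?G. \<Sum>b\<in>?G. prob (A a \<inter> A b)) / (\<Sum>a\<in>?G. prob (A a))\<^sup>2 - 1"
    using m by (intro prob_none_le_second_moment A_sets)
      (auto simp: prob_A card_G intro: finite_PiE)
  also have "(\<Sum>a\<in>?G. prob (A a)) = real m ^ n * exp (- \<rho>)" by (simp add: prob_A card_G)
  also have "(\<Sum>a\<in>?G. \<Sum>b\<in>?G. prob (A a \<inter> A b))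
      = exp (- \<rho>) ^ 2 * (\<Sum>a\<in>?G. \<Sum>b\<in>?G. exp (\<rho> * ?p a b))"
    by (simp add: prob_AA sum_distrib_left)
  finally show ?thesis by (simp add: power_mult_distrib)
qed

subsection \<open>Asymptotics\<close>

text \<open>One summand for each range of \<open>k\<close>: for k < 20 the power of
  \<open>\<rho>\<close> is polynomial in \<open>n\<close>; for 20 \<le> k \<le> n / ln n it is at
  most exp (2 n); beyond that D_k itself is small.\<close>

lemma overlap_term_le:
  fixes \<rho> :: real
  assumes n: "n \<ge> 50" and \<rho>: "0 \<le> \<rho>" "\<rho> \<le> real n * ln (real n)" and k: "k \<ge> 1"
  shows "\<rho> ^ k * overlap_moment n k ^ n
       \<le> (1 + real n * ln (real n)) ^ 20 * (3 / 4) ^ n + (exp 2 / 9) ^ n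
         + \<rho> ^ k * (3 * ln (real n) / real n) ^ n"
proof -
  let ?A = "(1 + real n * ln (real n)) ^ 20 * (3 / 4) ^ n" and ?B = "(exp 2 / 9 :: real) ^ n"
  let ?C = "\<rho> ^ k * (3 * ln (real n) / real n) ^ n"
  have ln1: "1 \<le> ln (real n)"
    using n exp_le by (intro ln_ge_iff[THEN iffD2]) auto
  have nonneg: "0 \<le> ?A" "0 \<le> ?B" "0 \<le> ?C" using ln1 \<rho> n by auto
  have D: "overlap_moment n k \<le> 1 / real n + 2 / real (k + 2)" "0 \<le> overlap_moment n k"
    using n overlap_moment_le[of n k] by (simp_all add: overlap_moment_nonneg)
  have n50: "1 / real n \<le> 1 / 50" using n by (intro divide_left_mono) auto
  consider "k < 20" | "20 \<le> k" "real k * ln (real n) \<le> real n" | "real n < real k * ln (real n)"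
    by linarith
  then have "\<rho> ^ k * overlap_moment n k ^ n \<le> ?A \<or> \<rho> ^ k * overlap_moment n k ^ n \<le> ?B
      \<or> \<rho> ^ k * overlap_moment n k ^ n \<le> ?C"
  proof cases
    case 1
    have "2 / real (k + 2) \<le> 2 / 3" using k by (intro divide_left_mono) auto
    then have "overlap_moment n k \<le> 3 / 4" using D n50 by linarith
    \<comment> \<open>Adding 1 makes the base at least 1, so the exponent may be raised to
      20.\<close>
    moreover have "\<rho> ^ k \<le> (1 + real n * ln (real n)) ^ k" using \<rho> by (intro power_mono) auto
    moreover have "\<dots> \<le> (1 + real n * ln (real n)) ^ 20"
      using 1 \<rho> by (intro power_increasing) auto
    ultimately have "\<rho> ^ k * overlap_moment n k ^ n \<le> ?A"
      using D \<rho> by (intro mult_mono power_mono) auto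
    then show ?thesis by blast
  next
    case 2
    have "2 / real (k + 2) \<le> 2 / 22" using 2 by (intro divide_left_mono) auto
    \<comment> \<open>The thresholds 20 and 50 serve this: 2/22 + 1/50 < 1/9, and 1/9 < exp (-2)
      beats the growth exp (2 n) of the power of \<open>\<rho>\<close>.\<close>
    then have D9: "overlap_moment n k \<le> 1 / 9" using D n50 by linarith
    have "ln (real n) \<le> real n" using ln_le_minus_one[of "real n"] n by simp
    then have "\<rho> \<le> real n * real n" using \<rho>(2) mult_left_mono[of "ln (real n)" "real n" "real n"] by simp
    then have "\<rho> \<le> exp (2 * ln (real n))" using n by (simp add: exp_double power2_eq_square)
    then have "\<rho> ^ k \<le> exp (2 * ln (real n)) ^ k" using \<rho> by (intro power_mono)
    also have "\<dots> = exp (2 * (real k * ln (real n)))"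
      by (simp add: exp_of_nat_mult[symmetric] mult_ac)
    also have "\<dots> \<le> exp (2 * real n)" using 2 by simp
    also have "\<dots> = exp 2 ^ n" by (simp add: exp_of_nat2_mult)
    finally have "\<rho> ^ k * overlap_moment n k ^ n \<le> exp 2 ^ n * (1 / 9) ^ n"
      using D D9 \<rho> by (intro mult_mono power_mono) auto
    also have "\<dots> = ?B" by (simp add: power_divide)
    finally show ?thesis by blast
  next
    case 3
    \<comment> \<open>Here k > n / ln n. Together with 1/n \<le> ln n / n this yields the constant
      3.\<close>
    have "2 / real (k + 2) \<le> 2 * ln (real n) / real n"
      using 3 ln1 n by (simp add: field_simps)
    moreover have "1 / real n \<le> ln (real n) / real n" using ln1 n by (intro divide_right_mono) auto
    moreover have "ln (real n) / real n + 2 * ln (real n) / real n = 3 * ln (real n) / real n"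
      by (simp add: add_divide_distrib[symmetric])
    ultimately have "overlap_moment n k \<le> 3 * ln (real n) / real n" using D by linarith
    then have "\<rho> ^ k * overlap_moment n k ^ n \<le> ?C"
      using D \<rho> by (intro mult_left_mono power_mono) auto
    then show ?thesis by blast
  qed
  then show ?thesis using nonneg by linarith
qed

lemma grid_exp_sum_le:
  fixes \<rho> :: real
  assumes n: "n \<ge> 50" and \<rho>: "0 \<le> \<rho>" "\<rho> \<le> real n * ln (real n)"
  shows "(\<Sum>x\<in>{..<n} \<rightarrow>\<^sub>E {..<n}. \<Sum>y\<in>{..<n} \<rightarrow>\<^sub>E {..<n}.
            exp (\<rho> * (\<Prod>i<n. 1 - \<bar>real (x i) - real (y i)\<bar> / real n))) / (real n ^ n) ^ 2 - 1
       \<le> exp 1 * ((1 + real n * ln (real n)) ^ 20 * (3 / 4) ^ n + (exp 2 / 9) ^ n)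
         + exp \<rho> * (3 * ln (real n) / real n) ^ n"
    (is "?W \<le> exp 1 * ?A + exp \<rho> * ?C")
proof -
  have exps: "(\<lambda>k. x ^ Suc k / fact (Suc k)) sums (exp x - 1)" for x :: real
    using exp_converges[of x] by (subst sums_Suc_iff) (simp add: divide_inverse mult.commute)
  have sums1: "(\<lambda>k. \<rho> ^ Suc k / fact (Suc k) * overlap_moment n (Suc k) ^ n) sums ?W"
    using n by (intro sum_grid_exp) auto
  \<comment> \<open>The bounds free of \<open>k\<close> sum against 1/k!, the exponential series at
    1; the third sums against \<rho>^k / k!, the series at \<open>\<rho>\<close>.\<close>
  have sums2: "(\<lambda>k. 1 ^ Suc k / fact (Suc k) * ?A + \<rho> ^ Suc k / fact (Suc k) * ?C)
      sums ((exp 1 - 1) * ?A + (exp \<rho> - 1) * ?C)"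
    by (intro sums_add sums_mult2 exps)
  have "\<rho> ^ Suc k / fact (Suc k) * overlap_moment n (Suc k) ^ n
      \<le> 1 ^ Suc k / fact (Suc k) * ?A + \<rho> ^ Suc k / fact (Suc k) * ?C" for k
    using divide_right_mono[OF overlap_term_le[OF n \<rho>, of "Suc k"], of "fact (Suc k)"]
    by (simp add: add_divide_distrib)
  then have "?W \<le> (exp 1 - 1) * ?A + (exp \<rho> - 1) * ?C" by (rule sums_le[OF _ sums1 sums2])
  also have "\<dots> \<le> exp 1 * ?A + exp \<rho> * ?C"
    using n by (intro add_mono mult_right_mono) auto
  finally show ?thesis .
qed

lemma grid_exp_bound_tendsto:
  assumes "\<delta> > 0"
  shows "(\<lambda>n. exp 1 * ((1 + real n * ln (real n)) ^ 20 * (3 / 4) ^ n + (exp 2 / 9) ^ n)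
         + exp (intensity \<delta> n) * (3 * ln (real n) / real n) ^ n) \<longlonglongrightarrow> 0"
proof -
  have A: "(\<lambda>n. (1 + real n * ln (real n)) ^ 20 * (3 / 4) ^ n) \<longlonglongrightarrow> 0" by real_asymp
  have "exp 2 < (9 :: real)"
  proof -
    have "exp (2::real) = exp 1 ^ 2" by (simp add: exp_double[symmetric])
    also have "\<dots> < 3 ^ 2"  using e_less_272 by (intro power_strict_mono) auto
    finally show ?thesis by simp
  qed
  then have B: "(\<lambda>n. (exp 2 / 9 :: real) ^ n) \<longlonglongrightarrow> 0" by (intro LIMSEQ_power_zero) auto
  \<comment> \<open>In the exponent n ln n cancels against the factor n^(-n), and (ln n)^n absorbs
    one of the 1 + \<delta> copies of n ln ln n. The remaining \<delta> n ln ln n outgrows n ln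
    3.\<close>
  have "(\<lambda>n. exp (real n * ln 3 - \<delta> * real n * ln (ln (real n)))) \<longlonglongrightarrow> 0"
    using assms by real_asymp
  moreover have "eventually (\<lambda>n. exp (real n * ln 3 - \<delta> * real n * ln (ln (real n)))
      = exp (intensity \<delta> n) * (3 * ln (real n) / real n) ^ n) sequentially"
    using eventually_ge_at_top[of 2]
  proof eventually_elim
    case (elim n)
    then have pos: "0 < ln (real n)" by simp
    then have "(3 * ln (real n) / real n) ^ n = exp (real n * ln (3 * ln (real n) / real n))"
      using elim by (simp add: exp_of_nat_mult)
    also have "ln (3 * ln (real n) / real n) = ln 3 + ln (ln (real n)) - ln (real n)"
      using pos elim by (simp add: ln_mult ln_div)
    finally show ?case by (simp add: exp_add[symmetric] intensity_def algebra_simps)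
  qed
  ultimately have C: "(\<lambda>n. exp (intensity \<delta> n) * (3 * ln (real n) / real n) ^ n) \<longlonglongrightarrow> 0"
    by (rule Lim_transform_eventually)
  show ?thesis
    using tendsto_add[OF tendsto_mult_left[OF tendsto_add[OF A B], of "exp 1"] C] by simp
qed

theorem theorem1p4:
  fixes \<delta> :: real
    and \<Lambda> :: "nat \<Rightarrow> (nat \<Rightarrow> real) set"
    and M :: "nat \<Rightarrow> 'w measure"
    and X :: "nat \<Rightarrow> 'w \<Rightarrow> (nat \<Rightarrow> real) set set"
  assumes "\<delta> > 0"
    and "\<And>n. n \<ge> 1 \<Longrightarrow> packing_lattice n (\<Lambda> n) (minkowski_diff n (cube n) (cube n))"
    and "\<And>n. n \<ge> 2 \<Longrightarrow> intensity \<delta> n \<ge> 0 \<Longrightarrow>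
           poisson_process (M n) (X n) (torus_measure n (\<Lambda> n)) (intensity \<delta> n)"
  shows "(\<lambda>n. measure (M n)
            {\<omega> \<in> space (M n). torus n (\<Lambda> n) \<subseteq> torus_plus n (\<Lambda> n) (X n \<omega>) (cube n)})
           \<longlonglongrightarrow> 0"
proof -
  let ?B = "\<lambda>n. exp 1 * ((1 + real n * ln (real n)) ^ 20 * (3 / 4) ^ n + (exp 2 / 9) ^ n)
         + exp (intensity \<delta> n) * (3 * ln (real n) / real n) ^ n"
  \<comment> \<open>The process is assumed only where the intensity is nonnegative, which holds for
    all large \<open>n\<close>.\<close>
  have "eventually (\<lambda>n. 0 \<le> real n * ln (real n) - (1 + \<delta>) * real n * ln (ln (real n))) sequentially"
    by real_asymp
  then have "eventually (\<lambda>n. measure (M n)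
      {\<omega> \<in> space (M n). torus n (\<Lambda> n) \<subseteq> torus_plus n (\<Lambda> n) (X n \<omega>) (cube n)} \<le> ?B n) sequentially"
    using eventually_ge_at_top[of 50]
  proof eventually_elim
    case (elim n)
    then have pos: "0 \<le> intensity \<delta> n" by (simp add: intensity_def)
    \<comment> \<open>This gives ln ln n \<ge> 0, so the subtracted term of the intensity is
      nonnegative.\<close>
    have "1 \<le> ln (real n)" using elim exp_le by (intro ln_ge_iff[THEN iffD2]) auto
    then have "0 \<le> (1 + \<delta>) * real n * ln (ln (real n))" using assms(1) by simp
    then have "intensity \<delta> n \<le> real n * ln (real n)" by (simp add: intensity_def)
    note bound = grid_exp_sum_le[OF elim(2) pos this]
    have "packing_lattice n (\<Lambda> n) (minkowski_diff n (cube n) (cube n))"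
      "poisson_process (M n) (X n) (torus_measure n (\<Lambda> n)) (intensity \<delta> n)" "n > 0"
      using assms(2,3) elim pos by auto
    \<comment> \<open>The grid size is taken as m = n, fine enough that the diagonal term 1/m of D_k
      stays below ln n / n.\<close>
    from order_trans[OF cover_prob_le[OF this] bound] show ?case .
  qed
  then show ?thesis
    by (intro tendsto_sandwich[OF _ _ tendsto_const grid_exp_bound_tendsto[OF assms(1)]])
      (auto intro: always_eventually)
qed

end
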